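(* Let $n\geq 4$, let $\langle A\mid R\rangle$ be any monoid presentation for the symmetric group $S_n$, and let $\langle A,\zeta\mid R,S\rangle$ be a monoid presentation for the full transformation monoid $T_n$, where $\zeta$ represents the idempotent of rank $n-1$ in $T_n$ with $(2)\zeta=1$. Then there are at least two relations of rank $n-2$ in $S$.
   Context: Maps act on the right and are composed from left to right. $T_n$ is the monoid of all maps from $\{1,\ldots,n\}$ to itself; its group of units is $S_n$; the rank of an element is the size of its image. A monoid presentation $\langle X\mid Q\rangle$ with $Q\subseteq X^*\times X^*$ defines the quotient of the free monoid $X^*$ by the least congruence $Q^{\sharp}$ containing $Q$; $\langle A,\zeta\mid R,S\rangle$ means $\langle A\cup\{\zeta\}\mid R\cup S\rangle$, with $\zeta\notin A$. The letters of $A$ represent permutations in $S_n$, and $\phi:(A\cup\{\zeta\})^*\to T_n$ denotes the surjective homomorphism sending each letter to the element it represents; its kernel is the congruence generated by $R\cup S$, and its restriction to $A^*$ has image $S_n$ and kernel the congruence on $A^*$ generated by $R$. A word $w$ has rank $r$ if $(w)\phi$ has rank $r$; a relation $(u,v)$ has rank $r$ if $u$ (equivalently $v$) has rank $r$. *)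

theory Defs
  imports "HOL-Algebra.Bij"
begin

text \<open>Monoid presentations. Words over an alphabet \<open>X\<close> are the elements of \<open>lists X\<close>, the free
  monoid on \<open>X\<close> under concatenation.\<close>

definition word_congruence :: "'a set \<Rightarrow> ('a list \<times> 'a list) set \<Rightarrow> bool" where
  "word_congruence X \<rho> \<longleftrightarrow>
     equiv (lists X) \<rho> \<and>
     (\<forall>u v u' v'. (u, v) \<in> \<rho> \<longrightarrow> (u', v') \<in> \<rho> \<longrightarrow> (u @ u', v @ v') \<in> \<rho>)"

definition generated_congruence ::
  "'a set \<Rightarrow> ('a list \<times> 'a list) set \<Rightarrow> ('a list \<times> 'a list) set" where
  "generated_congruence X Q = \<Inter> {\<rho>. word_congruence X \<rho> \<and> Q \<subseteq> \<rho>}"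

text \<open>For \<open>f\<close> mapping letters into \<open>carrier M\<close>, this is the unique extension of \<open>f\<close> to a homomorphism
  from words to \<open>M\<close>.\<close>

definition word_value :: "('b, 'c) monoid_scheme \<Rightarrow> ('a \<Rightarrow> 'b) \<Rightarrow> 'a list \<Rightarrow> 'b" where
  "word_value M f w = foldr (\<lambda>x m. f x \<otimes>\<^bsub>M\<^esub> m) w \<one>\<^bsub>M\<^esub>"

text \<open>\<open>\<langle>X | Q\<rangle>\<close> is a presentation of \<open>M\<close> in which the letter \<open>x\<close> represents \<open>f x\<close>: the induced
  homomorphism is onto \<open>M\<close> and its kernel is the congruence generated by \<open>Q\<close>.\<close>

definition presents_via ::
  "('b, 'c) monoid_scheme \<Rightarrow> ('a \<Rightarrow> 'b) \<Rightarrow> 'a set \<Rightarrow> ('a list \<times> 'a list) set \<Rightarrow> bool" where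
  "presents_via M f X Q \<longleftrightarrow>
     f ` X \<subseteq> carrier M \<and>
     Q \<subseteq> lists X \<times> lists X \<and>
     word_value M f ` lists X = carrier M \<and>
     {(u, v) \<in> lists X \<times> lists X. word_value M f u = word_value M f v}
       = generated_congruence X Q"

text \<open>Maps act on the right, so the product of \<open>f\<close> and \<open>g\<close> is \<open>f\<close> followed by \<open>g\<close>
  (note that \<^const>\<open>compose\<close> takes its arguments in the opposite order). A map is represented by a
  function that is undefined outside \<open>{1..n}\<close>.\<close>

definition full_transformation_monoid :: "nat \<Rightarrow> (nat \<Rightarrow> nat) monoid" where
  "full_transformation_monoid n =
     \<lparr>carrier = {1..n} \<rightarrow>\<^sub>E {1..n},
      mult = (\<lambda>f g. compose {1..n} g f),
      one = (\<lambda>i\<in>{1..n}. i)\<rparr>"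

definition symmetric_group :: "nat \<Rightarrow> (nat \<Rightarrow> nat) monoid" where
  "symmetric_group n =
     \<lparr>carrier = Bij {1..n},
      mult = (\<lambda>f g. compose {1..n} g f),
      one = (\<lambda>i\<in>{1..n}. i)\<rparr>"

definition trans_rank :: "nat \<Rightarrow> (nat \<Rightarrow> nat) \<Rightarrow> nat" where
  "trans_rank n f = card (f ` {1..n})"

definition word_rank :: "nat \<Rightarrow> ('a \<Rightarrow> nat \<Rightarrow> nat) \<Rightarrow> 'a list \<Rightarrow> nat" where
  "word_rank n f w = trans_rank n (word_value (full_transformation_monoid n) f w)"

text \<open>Only meaningful for relations whose two sides have the same value, hence the same rank.\<close>

definition relation_rank :: "nat \<Rightarrow> ('a \<Rightarrow> nat \<Rightarrow> nat) \<Rightarrow> 'a list \<times> 'a list \<Rightarrow> nat" where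
  "relation_rank n f r = word_rank n f (fst r)"

end

theory Submission
  imports Defs "HOL-Library.Sublist"
begin

text \<open>
  Record for each word the kernels of its prefixes of rank \<open>n - 1\<close>; all these kernels coincide.
  Rewriting a word \<open>x u y\<close> of rank \<open>n - 2\<close> to \<open>x v y\<close> can only change the recorded kernel if \<open>u\<close> has
  rank \<open>n - 2\<close> and \<open>x\<close> represents a permutation, and then \<open>u\<close> has the same kernel type as \<open>x u y\<close>:
  either both kernels have a class of size three, or both have two classes of size two.
  For each of the two types there are words with equal value but different recorded kernels, namely
  \<open>e f\<close> and \<open>f e\<close> for commuting idempotents \<open>e\<close> and \<open>f\<close> of rank \<open>n - 1\<close>. Hence \<open>S\<close> has a relation of
  rank \<open>n - 2\<close> of each type.
\<close>

declare One_nat_def [simp del]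

section \<open>Values of words, and the monoid of all maps\<close>

lemma (in monoid) word_value_closed:
  assumes "f ` X \<subseteq> carrier G" and "w \<in> lists X"
  shows "word_value G f w \<in> carrier G"
  using assms(2,1) by (induction w) (auto simp: word_value_def)

lemma (in monoid) word_value_append:
  assumes "f ` X \<subseteq> carrier G" and "u \<in> lists X" and "v \<in> lists X"
  shows "word_value G f (u @ v) = word_value G f u \<otimes> word_value G f v"
  using assms(2)
proof (induction u)
  case Nil
  then show ?case
    using word_value_closed[OF assms(1,3)] by (simp add: word_value_def)
next
  case (Cons x u)
  have "f x \<in> carrier G" "u \<in> lists X"
    using Cons.hyps assms(1) by auto
  then show ?case
    using Cons.IH word_value_closed[OF assms(1,3)] word_value_closed[OF assms(1), of u]
    by (simp add: word_value_def m_assoc)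
qed

lemma carrier_full_transformation_monoid [simp]:
  "carrier (full_transformation_monoid n) = {1..n} \<rightarrow>\<^sub>E {1..n}"
  and mult_full_transformation_monoid [simp]:
  "f \<otimes>\<^bsub>full_transformation_monoid n\<^esub> g = compose {1..n} g f"
  and one_full_transformation_monoid [simp]:
  "\<one>\<^bsub>full_transformation_monoid n\<^esub> = (\<lambda>i\<in>{1..n}. i)"
  by (simp_all add: full_transformation_monoid_def)

lemma monoid_full_transformation_monoid: "monoid (full_transformation_monoid n)"
proof (rule monoidI)
  fix f g h
  assume "f \<in> carrier (full_transformation_monoid n)"
  then show "f \<otimes>\<^bsub>full_transformation_monoid n\<^esub> g \<otimes>\<^bsub>full_transformation_monoid n\<^esub> h
      = f \<otimes>\<^bsub>full_transformation_monoid n\<^esub> (g \<otimes>\<^bsub>full_transformation_monoid n\<^esub> h)"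
    by (auto simp: compose_def fun_eq_iff)
next
  fix f g
  assume "f \<in> carrier (full_transformation_monoid n)" "g \<in> carrier (full_transformation_monoid n)"
  then show "f \<otimes>\<^bsub>full_transformation_monoid n\<^esub> g \<in> carrier (full_transformation_monoid n)"
    by (auto simp: compose_def)
next
  fix f
  assume f: "f \<in> carrier (full_transformation_monoid n)"
  then show "\<one>\<^bsub>full_transformation_monoid n\<^esub> \<otimes>\<^bsub>full_transformation_monoid n\<^esub> f = f"
    by (auto simp: compose_def fun_eq_iff PiE_def extensional_def)
  show "f \<otimes>\<^bsub>full_transformation_monoid n\<^esub> \<one>\<^bsub>full_transformation_monoid n\<^esub> = f"
    using f by (auto simp: compose_def fun_eq_iff PiE_def extensional_def)
qed auto

text \<open>Evaluation uses only product and identity, and the two structures differ only in their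
  carriers. Relations of \<open>R\<close> can therefore be ranked inside the full transformation
  monoid.\<close>

lemma word_value_symmetric_group:
  "word_value (symmetric_group n) f w = word_value (full_transformation_monoid n) f w"
  by (simp add: word_value_def symmetric_group_def full_transformation_monoid_def)

section \<open>Kernels and ranks of products\<close>

definition map_kernel :: "nat \<Rightarrow> (nat \<Rightarrow> nat) \<Rightarrow> (nat \<times> nat) set" where
  "map_kernel n f = {(i, j) \<in> {1..n} \<times> {1..n}. f i = f j}"

text \<open>For the kernel of a map of rank \<open>n - 2\<close> this one bit is the kernel type: it
  separates one class of size three from two classes of size two. Two pairs suffice because kernels
  are transitive.\<close>

definition has_triple :: "(nat \<times> nat) set \<Rightarrow> bool" where
  "has_triple K \<longleftrightarrow> (\<exists>i j k. distinct [i, j, k] \<and> (i, j) \<in> K \<and> (j, k) \<in> K)"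

lemma trans_rank_compose: "trans_rank n (compose {1..n} g f) = card (g ` f ` {1..n})"
  by (auto simp: trans_rank_def compose_def image_image intro!: arg_cong[where f = card])

lemma trans_rank_compose_le: "trans_rank n (compose {1..n} g f) \<le> trans_rank n f"
  unfolding trans_rank_compose by (simp add: trans_rank_def card_image_le)

lemma map_kernel_compose:
  assumes "f \<in> {1..n} \<rightarrow>\<^sub>E {1..n}"
  shows "map_kernel n (compose {1..n} g f)
    = {(i, j) \<in> {1..n} \<times> {1..n}. (f i, f j) \<in> map_kernel n g}"
  using assms by (auto simp: map_kernel_def compose_def PiE_iff)

text \<open>Equal ranks force \<open>g\<close> to be injective on the image of \<open>f\<close>, so
  \<open>g\<close> merges no further points.\<close>

lemma map_kernel_compose_eq:
  assumes "trans_rank n (compose {1..n} g f) = trans_rank n f"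
  shows "map_kernel n (compose {1..n} g f) = map_kernel n f"
proof -
  have "inj_on g (f ` {1..n})"
    using assms unfolding trans_rank_compose by (intro eq_card_imp_inj_on) (auto simp: trans_rank_def)
  then show ?thesis
    by (auto simp: map_kernel_def compose_def inj_on_def)
qed

lemma bij_betw_if_full_trans_rank:
  assumes "f \<in> {1..n} \<rightarrow>\<^sub>E {1..n}" and "n \<le> trans_rank n f"
  shows "bij_betw f {1..n} {1..n}"
proof -
  have sub: "f ` {1..n} \<subseteq> {1..n}"
    using assms(1) by auto
  have "f ` {1..n} = {1..n}"
    using assms(2) sub by (intro card_seteq) (auto simp: trans_rank_def)
  moreover from this have "inj_on f {1..n}"
    by (intro eq_card_imp_inj_on) auto
  ultimately show ?thesis
    by (simp add: bij_betw_def)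
qed

lemma trans_rank_compose_bij:
  assumes "bij_betw f {1..n} {1..n}"
  shows "trans_rank n (compose {1..n} g f) = trans_rank n g"
  using assms unfolding trans_rank_compose by (simp add: trans_rank_def bij_betw_def)

text \<open>A permutation applied first only relabels points and preserves the sizes of kernel
  classes. Hence the kernel type survives the removal of a left factor that is a
  permutation.\<close>

lemma has_triple_compose_bij:
  assumes "bij_betw f {1..n} {1..n}"
  shows "has_triple (map_kernel n (compose {1..n} g f)) \<longleftrightarrow> has_triple (map_kernel n g)"
proof
  assume "has_triple (map_kernel n (compose {1..n} g f))"
  then obtain i j k where *: "distinct [i, j, k]" "i \<in> {1..n}" "j \<in> {1..n}" "k \<in> {1..n}"
    "g (f i) = g (f j)" "g (f j) = g (f k)"
    by (auto simp: has_triple_def map_kernel_def compose_def)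
  then have "distinct [f i, f j, f k]" "f i \<in> {1..n}" "f j \<in> {1..n}" "f k \<in> {1..n}"
    using bij_betw_apply[OF assms] by (simp_all add: inj_on_eq_iff[OF bij_betw_imp_inj_on[OF assms]])
  with * show "has_triple (map_kernel n g)"
    unfolding has_triple_def map_kernel_def by blast
next
  assume "has_triple (map_kernel n g)"
  then obtain i j k where *: "distinct [i, j, k]" "i \<in> {1..n}" "j \<in> {1..n}" "k \<in> {1..n}"
    "g i = g j" "g j = g k"
    by (auto simp: has_triple_def map_kernel_def)
  have "\<exists>a\<in>{1..n}. x = f a" if "x \<in> {1..n}" for x
    using assms that by (auto simp: bij_betw_def)
  with * obtain a b c where "a \<in> {1..n}" "b \<in> {1..n}" "c \<in> {1..n}" "i = f a" "j = f b" "k = f c"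
    by metis
  with * have "distinct [a, b, c]" "(a, b) \<in> map_kernel n (compose {1..n} g f)"
    "(b, c) \<in> map_kernel n (compose {1..n} g f)"
    by (auto simp: map_kernel_def compose_def)
  then show "has_triple (map_kernel n (compose {1..n} g f))"
    unfolding has_triple_def by blast
qed

section \<open>The kernel recorded along a word\<close>

text \<open>Recording a set avoids both the choice of a prefix and a default value when no prefix
  has rank \<open>n - 1\<close>. It has at most one element if the letters of \<open>w\<close>
  represent elements of the full transformation monoid.\<close>

definition prefix_kernels :: "nat \<Rightarrow> ('a \<Rightarrow> nat \<Rightarrow> nat) \<Rightarrow> 'a list \<Rightarrow> (nat \<times> nat) set set" where
  "prefix_kernels n \<phi> w =
     (\<lambda>p. map_kernel n (word_value (full_transformation_monoid n) \<phi> p)) `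
       {p. prefix p w \<and> word_rank n \<phi> p = n - 1}"

context
  fixes n :: nat and \<phi> :: "'a \<Rightarrow> nat \<Rightarrow> nat" and X :: "'a set"
  assumes letters: "\<phi> ` X \<subseteq> carrier (full_transformation_monoid n)"
begin

private abbreviation val :: "'a list \<Rightarrow> nat \<Rightarrow> nat" where
  "val \<equiv> word_value (full_transformation_monoid n) \<phi>"

lemma val_closed: "w \<in> lists X \<Longrightarrow> val w \<in> {1..n} \<rightarrow>\<^sub>E {1..n}"
  using monoid.word_value_closed[OF monoid_full_transformation_monoid letters] by simp

lemma val_append:
  "u \<in> lists X \<Longrightarrow> v \<in> lists X \<Longrightarrow> val (u @ v) = compose {1..n} (val v) (val u)"
  using monoid.word_value_append[OF monoid_full_transformation_monoid letters] by simp

lemma word_rank_append_le: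
  "u \<in> lists X \<Longrightarrow> v \<in> lists X \<Longrightarrow> word_rank n \<phi> (u @ v) \<le> word_rank n \<phi> u"
  by (simp add: word_rank_def val_append trans_rank_compose_le)

lemma map_kernel_append_eq:
  assumes "u \<in> lists X" and "v \<in> lists X" and "word_rank n \<phi> (u @ v) = word_rank n \<phi> u"
  shows "map_kernel n (val (u @ v)) = map_kernel n (val u)"
  using assms by (simp add: word_rank_def val_append map_kernel_compose_eq)

lemma lists_prefix: "prefix p w \<Longrightarrow> w \<in> lists X \<Longrightarrow> p \<in> lists X"
  by (auto simp: prefix_def)

lemma word_rank_prefix_ge:
  "prefix p w \<Longrightarrow> w \<in> lists X \<Longrightarrow> word_rank n \<phi> w \<le> word_rank n \<phi> p"
  using word_rank_append_le by (metis append_in_lists_conv prefix_def)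

text \<open>The relevant prefixes all extend \<open>u\<close>, and prepending \<open>u\<close> pulls
  kernels back along \<open>val u\<close>. Thus \<open>u\<close> enters only through its
  value.\<close>

lemma prefix_kernels_append_perm:
  assumes "n \<ge> 1" and "u \<in> lists X" and "v \<in> lists X" and "n \<le> word_rank n \<phi> u"
  shows "prefix_kernels n \<phi> (u @ v)
    = (\<lambda>K. {(i, j) \<in> {1..n} \<times> {1..n}. (val u i, val u j) \<in> K}) ` prefix_kernels n \<phi> v"
proof -
  have bij: "bij_betw (val u) {1..n} {1..n}"
    using assms by (intro bij_betw_if_full_trans_rank val_closed) (simp_all add: word_rank_def)
  have rank: "word_rank n \<phi> (u @ p) = word_rank n \<phi> p" if "prefix p v" for p
    using lists_prefix[OF that assms(3)] assms(2)
    by (simp add: word_rank_def val_append trans_rank_compose_bij[OF bij])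
  have "{p. prefix p (u @ v) \<and> word_rank n \<phi> p = n - 1}
      = (@) u ` {p. prefix p v \<and> word_rank n \<phi> p = n - 1}" (is "?L = ?R")
  proof
    show "?L \<subseteq> ?R"
    proof
      fix p
      assume p: "p \<in> ?L"
      \<comment> \<open>Prefixes of \<open>u\<close> have rank at least \<open>n\<close>, and
        \<open>n - 1 < n\<close> because \<open>n \<ge> 1\<close>.\<close>
      have "\<not> prefix p u"
        using word_rank_prefix_ge[of p u] p assms by auto
      then show "p \<in> ?R"
        using p rank by (auto simp: prefix_append)
    qed
  qed (use rank in auto)
  moreover have "map_kernel n (val (u @ p))
      = {(i, j) \<in> {1..n} \<times> {1..n}. (val u i, val u j) \<in> map_kernel n (val p)}"
    if "prefix p v" for p
    using lists_prefix[OF that assms(3)] assms(2)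
    by (simp add: val_append map_kernel_compose[OF val_closed])
  ultimately show ?thesis
    by (auto simp: prefix_kernels_def image_image intro!: image_cong)
qed

text \<open>The word \<open>u\<close> is itself a recorded prefix, and every other one is comparable
  with it; equal ranks then give equal kernels.\<close>

lemma prefix_kernels_append_corank1:
  assumes "u \<in> lists X" and "v \<in> lists X" and "word_rank n \<phi> u = n - 1"
  shows "prefix_kernels n \<phi> (u @ v) = {map_kernel n (val u)}"
proof -
  have "map_kernel n (val p) = map_kernel n (val u)"
    if p: "prefix p (u @ v)" "word_rank n \<phi> p = n - 1" for p
  proof -
    consider q where "u = p @ q" | q where "p = u @ q"
      using p(1) by (metis prefix_append prefix_def)
    then show ?thesis
    proof cases
      case 1
      then show ?thesis
        using map_kernel_append_eq[of p q] assms p by auto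
    next
      case 2
      then show ?thesis
        using map_kernel_append_eq[of u q] assms p lists_prefix[OF p(1)] by auto
    qed
  qed
  moreover have "u \<in> {p. prefix p (u @ v) \<and> word_rank n \<phi> p = n - 1}"
    using assms by simp
  ultimately show ?thesis
    unfolding prefix_kernels_def by blast
qed

text \<open>Beyond \<open>u\<close> the rank cannot rise again, so nothing new is recorded.\<close>

lemma prefix_kernels_append_low:
  assumes "u \<in> lists X" and "v \<in> lists X" and "word_rank n \<phi> u < n - 1"
  shows "prefix_kernels n \<phi> (u @ v) = prefix_kernels n \<phi> u"
proof -
  have "word_rank n \<phi> (u @ p) \<noteq> n - 1" if "prefix p v" for p
    using word_rank_append_le[OF assms(1) lists_prefix[OF that assms(2)]] assms(3) by simp
  then show ?thesis
    by (auto simp: prefix_kernels_def prefix_append)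
qed

section \<open>A congruence for each kernel type\<close>

text \<open>The parameter \<open>b\<close> selects one of the two kernel types, so that each type
  later yields its own relation. The guard mentions only \<open>u\<close>, but it is symmetric
  because the values agree.\<close>

definition prefix_kernel_congruence :: "bool \<Rightarrow> ('a list \<times> 'a list) set" where
  "prefix_kernel_congruence b = {(u, v) \<in> lists X \<times> lists X. val u = val v \<and>
     (word_rank n \<phi> u = n - 2 \<and> has_triple (map_kernel n (val u)) = b \<longrightarrow>
       prefix_kernels n \<phi> u = prefix_kernels n \<phi> v)}"

text \<open>The rank of the left factor decides which given pair must have equal records: the right
  pair for a permutation, neither for rank \<open>n - 1\<close>, the left pair for rank
  \<open>n - 2\<close>. The rank of the product excludes anything lower.\<close>

lemma word_congruence_prefix_kernel_congruence:
  assumes "n \<ge> 2"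
  shows "word_congruence X (prefix_kernel_congruence b)"
  unfolding word_congruence_def
proof (intro conjI allI impI)
  show "equiv (lists X) (prefix_kernel_congruence b)"
    by (intro equivI) (auto simp: prefix_kernel_congruence_def refl_on_def sym_def trans_def word_rank_def)
next
  fix u v u' v'
  assume uv: "(u, v) \<in> prefix_kernel_congruence b" and uv': "(u', v') \<in> prefix_kernel_congruence b"
  then have words: "u \<in> lists X" "v \<in> lists X" "u' \<in> lists X" "v' \<in> lists X"
    and vals: "val u = val v" "val u' = val v'"
    by (auto simp: prefix_kernel_congruence_def)
  have "val (u @ u') = val (v @ v')"
    by (simp add: val_append words vals)
  moreover have "prefix_kernels n \<phi> (u @ u') = prefix_kernels n \<phi> (v @ v')"
    if low: "word_rank n \<phi> (u @ u') = n - 2"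
      and b: "has_triple (map_kernel n (val (u @ u'))) = b"
  proof -
    have rank_v: "word_rank n \<phi> v = word_rank n \<phi> u"
      by (simp add: word_rank_def vals)
    have "n - 2 \<le> word_rank n \<phi> u"
      using word_rank_append_le[OF words(1,3)] low by simp
    then consider "n \<le> word_rank n \<phi> u" | "word_rank n \<phi> u = n - 1" | "word_rank n \<phi> u = n - 2"
      by linarith
    then show ?thesis
    proof cases
      case 1
      have bij: "bij_betw (val u) {1..n} {1..n}"
        using 1 bij_betw_if_full_trans_rank val_closed words by (simp add: word_rank_def)
      have "word_rank n \<phi> u' = n - 2"
        using low by (simp add: word_rank_def val_append words trans_rank_compose_bij[OF bij])
      moreover have "has_triple (map_kernel n (val u')) = b"
        using b has_triple_compose_bij[OF bij] by (simp add: val_append words)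
      ultimately have "prefix_kernels n \<phi> u' = prefix_kernels n \<phi> v'"
        using uv' by (auto simp: prefix_kernel_congruence_def)
      then show ?thesis
        using 1 assms by (simp add: prefix_kernels_append_perm words rank_v vals)
    next
      case 2
      then show ?thesis
        by (simp add: prefix_kernels_append_corank1 words rank_v vals)
    next
      case 3
      \<comment> \<open>No rank is lost after \<open>u\<close>, so \<open>u\<close> already has
        kernel type \<open>b\<close>.\<close>
      then have "map_kernel n (val (u @ u')) = map_kernel n (val u)"
        using low by (intro map_kernel_append_eq words) simp
      then have "prefix_kernels n \<phi> u = prefix_kernels n \<phi> v"
        using uv b 3 by (auto simp: prefix_kernel_congruence_def)
      \<comment> \<open>Here \<open>n \<ge> 2\<close> gives \<open>n - 2 < n - 1\<close>.\<close>
      then show ?thesis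
        using 3 assms by (simp add: prefix_kernels_append_low words rank_v)
    qed
  qed
  ultimately show "(u @ u', v @ v') \<in> prefix_kernel_congruence b"
    using words by (auto simp: prefix_kernel_congruence_def)
qed

end

section \<open>Commuting idempotents of rank \<open>n - 1\<close>\<close>

text \<open>For distinct \<open>j\<close> and \<open>k\<close> in \<open>{1..n}\<close> these are
  exactly the idempotents of rank \<open>n - 1\<close>; the only nontrivial kernel class is
  \<open>{j, k}\<close>.\<close>

definition merge_point :: "nat \<Rightarrow> nat \<Rightarrow> nat \<Rightarrow> nat \<Rightarrow> nat" where
  "merge_point n j k = (\<lambda>i\<in>{1..n}. if i = k then j else i)"

lemma merge_point_closed:
  "j \<in> {1..n} \<Longrightarrow> merge_point n j k \<in> carrier (full_transformation_monoid n)"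
  by (auto simp: merge_point_def)

lemma trans_rank_merge_point:
  assumes "j \<in> {1..n}" and "k \<in> {1..n}" and "j \<noteq> k"
  shows "trans_rank n (merge_point n j k) = n - 1"
proof -
  have "merge_point n j k ` {1..n} = {1..n} - {k}"
    using assms by (auto simp: merge_point_def image_iff)
  then show ?thesis
    using assms by (simp add: trans_rank_def)
qed

lemma commuting_merge_points:
  assumes "n \<ge> 4"
  obtains j k where "j \<in> {1..n}" "k \<in> {1..n}" "j \<noteq> k"
    "compose {1..n} (merge_point n j k) (merge_point n 1 2)
      = compose {1..n} (merge_point n 1 2) (merge_point n j k)"
    "trans_rank n (compose {1..n} (merge_point n j k) (merge_point n 1 2)) = n - 2"
    "has_triple (map_kernel n (compose {1..n} (merge_point n j k) (merge_point n 1 2))) = b"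
    "map_kernel n (merge_point n 1 2) \<noteq> map_kernel n (merge_point n j k)"
proof (cases b)
  case True
  \<comment> \<open>Both idempotents fix 1 and send their moved point there, so they commute and the
    product has the kernel class \<open>{1, 2, 3}\<close>.\<close>
  define g where "g = compose {1..n} (merge_point n 1 3) (merge_point n 1 2)"
  have g: "g = (\<lambda>i\<in>{1..n}. if i = 2 \<or> i = 3 then 1 else i)"
    using assms by (auto simp: g_def compose_def merge_point_def fun_eq_iff)
  have "g ` {1..n} = {1..n} - {2, 3}"
    using assms by (auto simp: g image_iff)
  then have "trans_rank n g = n - 2"
    using assms by (simp add: trans_rank_def card_Diff_subset)
  moreover have "has_triple (map_kernel n g)"
    unfolding has_triple_def
    by (intro exI[of _ 1] exI[of _ 2] exI[of _ 3]) (use assms in \<open>auto simp: map_kernel_def g\<close>)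
  moreover have "g = compose {1..n} (merge_point n 1 2) (merge_point n 1 3)"
    using assms by (auto simp: g compose_def merge_point_def fun_eq_iff)
  moreover have "(1, 2) \<in> map_kernel n (merge_point n 1 2)" "(1, 2) \<notin> map_kernel n (merge_point n 1 3)"
    using assms by (auto simp: map_kernel_def merge_point_def)
  ultimately show ?thesis
    using that[of 1 3] assms True unfolding g_def by auto
next
  case False
  \<comment> \<open>The disjoint pairs \<open>{1, 2}\<close> and \<open>{3, 4}\<close> make the
    idempotents commute and are the two nontrivial kernel classes of the product. The point 4
    requires \<open>n \<ge> 4\<close>.\<close>
  define g where "g = compose {1..n} (merge_point n 3 4) (merge_point n 1 2)"
  have g: "g = (\<lambda>i\<in>{1..n}. if i = 2 then 1 else if i = 4 then 3 else i)"
    using assms by (auto simp: g_def compose_def merge_point_def fun_eq_iff)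
  have "g ` {1..n} = {1..n} - {2, 4}"
    using assms by (auto simp: g image_iff)
  then have "trans_rank n g = n - 2"
    using assms by (simp add: trans_rank_def card_Diff_subset)
  moreover have "\<not> has_triple (map_kernel n g)"
    by (auto simp: has_triple_def map_kernel_def g split: if_splits)
  moreover have "g = compose {1..n} (merge_point n 1 2) (merge_point n 3 4)"
    using assms by (auto simp: g compose_def merge_point_def fun_eq_iff)
  moreover have "(1, 2) \<in> map_kernel n (merge_point n 1 2)" "(1, 2) \<notin> map_kernel n (merge_point n 3 4)"
    using assms by (auto simp: map_kernel_def merge_point_def)
  ultimately show ?thesis
    using that[of 3 4] assms False unfolding g_def by auto
qed

section \<open>Relations forced by each kernel type\<close>

text \<open>Otherwise the congruence for type \<open>b\<close> would contain \<open>Q\<close>, hence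
  every pair of words with equal values, including the two orders of a commuting product.\<close>

lemma exists_relation_of_kernel_type:
  assumes "n \<ge> 4" and pres: "presents_via (full_transformation_monoid n) \<phi> X Q"
  obtains r where "r \<in> Q" "relation_rank n \<phi> r = n - 2"
    "has_triple (map_kernel n (word_value (full_transformation_monoid n) \<phi> (fst r))) = b"
proof -
  let ?T = "full_transformation_monoid n"
  let ?val = "word_value ?T \<phi>"
  have letters: "\<phi> ` X \<subseteq> carrier ?T"
    and Q: "Q \<subseteq> lists X \<times> lists X"
    and onto: "?val ` lists X = carrier ?T"
    and kernel: "{(u, v) \<in> lists X \<times> lists X. ?val u = ?val v} = generated_congruence X Q"
    using pres unfolding presents_via_def by blast+
  obtain j k where jk: "j \<in> {1..n}" "k \<in> {1..n}" "j \<noteq> k"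
    and comm: "compose {1..n} (merge_point n j k) (merge_point n 1 2)
      = compose {1..n} (merge_point n 1 2) (merge_point n j k)"
    and rank: "trans_rank n (compose {1..n} (merge_point n j k) (merge_point n 1 2)) = n - 2"
    and type: "has_triple (map_kernel n (compose {1..n} (merge_point n j k) (merge_point n 1 2))) = b"
    and neq: "map_kernel n (merge_point n 1 2) \<noteq> map_kernel n (merge_point n j k)"
    by (rule commuting_merge_points[OF assms(1)])
  \<comment> \<open>Any words for the two idempotents will do, since at rank \<open>n - 1\<close>
    the record depends only on the value.\<close>
  have "merge_point n 1 2 \<in> ?val ` lists X" "merge_point n j k \<in> ?val ` lists X"
    unfolding onto by (intro merge_point_closed; use assms(1) jk in simp)+
  then obtain u v where u: "u \<in> lists X" "?val u = merge_point n 1 2"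
    and v: "v \<in> lists X" "?val v = merge_point n j k"
    by (metis imageE)
  have "?val (u @ v) = ?val (v @ u)"
    using u v comm by (simp add: val_append[OF letters])
  then have uv: "(u @ v, v @ u) \<in> generated_congruence X Q"
    using u v unfolding kernel[symmetric] by auto
  have "prefix_kernels n \<phi> (u @ v) = {map_kernel n (merge_point n 1 2)}"
    using prefix_kernels_append_corank1[OF letters u(1) v(1)] u v assms(1)
      trans_rank_merge_point[of 1 n 2] by (simp add: word_rank_def)
  moreover have "prefix_kernels n \<phi> (v @ u) = {map_kernel n (merge_point n j k)}"
    using prefix_kernels_append_corank1[OF letters v(1) u(1)] u v
      trans_rank_merge_point[OF jk] by (simp add: word_rank_def)
  ultimately have "(u @ v, v @ u) \<notin> prefix_kernel_congruence n \<phi> X b"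
    using neq u v rank type
    by (simp add: prefix_kernel_congruence_def[OF letters] word_rank_def val_append[OF letters])
  then have "\<not> Q \<subseteq> prefix_kernel_congruence n \<phi> X b"
    using uv word_congruence_prefix_kernel_congruence[OF letters] assms(1)
    by (auto simp: generated_congruence_def)
  then obtain r where r: "r \<in> Q" "r \<notin> prefix_kernel_congruence n \<phi> X b"
    by blast
  \<comment> \<open>The two sides of \<open>r\<close> have equal values, so \<open>r\<close> can
    escape the congruence only by having rank \<open>n - 2\<close>, type \<open>b\<close> and
    different records.\<close>
  have "Q \<subseteq> {(u, v) \<in> lists X \<times> lists X. ?val u = ?val v}"
    unfolding kernel by (auto simp: generated_congruence_def)
  with r show ?thesis
    by (intro that[of r]) (auto simp: prefix_kernel_congruence_def[OF letters] relation_rank_def)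
qed

lemma relation_rank_symmetric_group:
  assumes "presents_via (symmetric_group n) \<phi> A R" and "r \<in> R"
  shows "relation_rank n \<phi> r = n"
proof -
  have "fst r \<in> lists A"
    using assms unfolding presents_via_def by auto
  then have "word_value (full_transformation_monoid n) \<phi> (fst r) \<in> Bij {1..n}"
    using assms(1) unfolding presents_via_def word_value_symmetric_group
    by (auto simp: symmetric_group_def)
  then show ?thesis
    by (simp add: relation_rank_def word_rank_def trans_rank_def Bij_def bij_betw_def)
qed

theorem lemma5p6:
  fixes n :: nat
    and A :: "'a set"
    and \<zeta> :: 'a
    and \<phi> :: "'a \<Rightarrow> nat \<Rightarrow> nat"
    and R S :: "('a list \<times> 'a list) set"
  assumes "n \<ge> 4"
    and "\<zeta> \<notin> A"
    and "presents_via (symmetric_group n) \<phi> A R"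
    and "presents_via (full_transformation_monoid n) \<phi> (A \<union> {\<zeta>}) (R \<union> S)"
    and "\<phi> \<zeta> \<otimes>\<^bsub>full_transformation_monoid n\<^esub> \<phi> \<zeta> = \<phi> \<zeta>"
    and "trans_rank n (\<phi> \<zeta>) = n - 1"
    and "\<phi> \<zeta> 2 = 1"
  shows "\<exists>r\<in>S. \<exists>s\<in>S. r \<noteq> s \<and> relation_rank n \<phi> r = n - 2 \<and> relation_rank n \<phi> s = n - 2"
proof -
  let ?triple = "\<lambda>r. has_triple (map_kernel n (word_value (full_transformation_monoid n) \<phi> (fst r)))"
  have "\<exists>r\<in>S. relation_rank n \<phi> r = n - 2 \<and> ?triple r = b" for b
  proof -
    obtain r where r: "r \<in> R \<union> S" "relation_rank n \<phi> r = n - 2" "?triple r = b"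
      by (rule exists_relation_of_kernel_type[OF assms(1,4)])
    \<comment> \<open>Relations of \<open>R\<close> have rank \<open>n\<close>, which differs from
      \<open>n - 2\<close>.\<close>
    have "r \<notin> R"
      using relation_rank_symmetric_group[OF assms(3), of r] r(2) assms(1) by auto
    with r show ?thesis
      by blast
  qed
  \<comment> \<open>The two relations are distinct because their kernel types differ.\<close>
  from this[of True] this[of False] show ?thesis
    by metis
qed

end
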